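(* Let $\pi=\langle \pi_1\ \cdots\ \pi_n\rangle$ be any signed permutation of size $n$. Then $$psrd(\pi)\ \geq\ n+1+c(BG(\pi))-2c_1(BG(\pi))-\begin{cases}0 & \text{if } \pi_1=1,\\ 2 & \text{otherwise.}\end{cases}$$
   Context: A signed permutation of size $n$ is a sequence $\pi=\langle\pi_1\ \cdots\ \pi_n\rangle$ of nonzero integers such that $(|\pi_1|,\ldots,|\pi_n|)$ is a permutation of $\{1,\ldots,n\}$; the identity is $\iota=\langle 1\ 2\ \cdots\ n\rangle$ (all signs positive). "$\pi_1=1$" means the first entry is $1$ with positive sign. For $1\le j\le n$, the prefix signed reversal $\overline{\rho}(1,j)$ transforms $\pi$ into $\langle -\pi_j\ -\pi_{j-1}\ \cdots\ -\pi_1\ \pi_{j+1}\ \cdots\ \pi_n\rangle$. $psrd(\pi)$ is the minimum number of prefix signed reversals whose successive application transforms $\pi$ into $\iota$. Breakpoint graph: let $\pi'=(\pi'_0,\pi'_1,\ldots,\pi'_{2n+1})$ with $\pi'_0=0$, $\pi'_{2n+1}=2n+1$ and, for $1\le i\le n$, $(\pi'_{2i-1},\pi'_{2i})=(2\pi_i-1,2\pi_i)$ if $\pi_i>0$ and $(2|\pi_i|,2|\pi_i|-1)$ if $\pi_i<0$. $BG(\pi)$ has one vertex for each position $p\in\{0,\ldots,2n+1\}$ (labelled $\pi'_p$); its black edges join the vertices at positions $2i$ and $2i+1$ for $0\le i\le n$, and its grey edges join the vertices labelled $2k$ and $2k+1$ for $0\le k\le n$. Every vertex has exactly one black and one grey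 edge, so $BG(\pi)$ decomposes uniquely into alternating cycles. $c(BG(\pi))$ is the number of these cycles; the length of a cycle is its number of black edges; $c_1(BG(\pi))$ is the number of cycles of length $1$. *)

theory Defs
  imports Main
begin

definition signed_permutation :: "nat \<Rightarrow> int list \<Rightarrow> bool" where
  "signed_permutation n \<pi> \<longleftrightarrow>
     length \<pi> = n \<and> distinct (map abs \<pi>) \<and> set (map abs \<pi>) = {1..int n}"

definition prefix_reversal :: "nat \<Rightarrow> int list \<Rightarrow> int list" where
  "prefix_reversal j \<pi> = map uminus (rev (take j \<pi>)) @ drop j \<pi>"

text \<open>The set under \<open>LEAST\<close> is nonempty for every signed permutation, see
  \<open>signed_permutation_sortable\<close> below.\<close>

definition psrd :: "int list \<Rightarrow> nat" where
  "psrd \<pi> = (LEAST k. \<exists>js. length js = k \<and> set js \<subseteq> {1..length \<pi>} \<and>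
               fold prefix_reversal js \<pi> = [1..int (length \<pi>)])"

text \<open>The vertices of the breakpoint graph are the positions in the list of labels. An edge carries
  its colour, so that a black and a grey edge may join the same two vertices.\<close>

definition bg_labels :: "int list \<Rightarrow> int list" where
  "bg_labels \<pi> =
     0 # concat (map (\<lambda>x. if x > 0 then [2 * x - 1, 2 * x] else [2 * \<bar>x\<bar>, 2 * \<bar>x\<bar> - 1]) \<pi>)
       @ [2 * int (length \<pi>) + 1]"

datatype colour = Black | Grey

type_synonym coloured_edge = "colour \<times> nat set"

definition breakpoint_graph :: "int list \<Rightarrow> coloured_edge set" where
  "breakpoint_graph \<pi> =
     {(Black, {2 * i, 2 * i + 1}) | i. i \<le> length \<pi>} \<union>
     {(Grey, {p, q}) | p q k. p < length (bg_labels \<pi>) \<and> q < length (bg_labels \<pi>) \<and> k \<le> length \<pi> \<and>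
        bg_labels \<pi> ! p = 2 * int k \<and> bg_labels \<pi> ! q = 2 * int k + 1}"

text \<open>An alternating cycle is identified with its set of coloured edges, so that rotating or
  reversing the sequence of vertices does not change it.\<close>

definition closed_walk_edges :: "nat list \<Rightarrow> coloured_edge set" where
  "closed_walk_edges vs =
     {(if even i then Black else Grey, {vs ! i, vs ! (Suc i mod length vs)}) | i. i < length vs}"

definition alternating_cycles :: "coloured_edge set \<Rightarrow> coloured_edge set set" where
  "alternating_cycles E =
     {closed_walk_edges vs | vs.
        vs \<noteq> [] \<and> even (length vs) \<and> distinct vs \<and> closed_walk_edges vs \<subseteq> E}"

definition cycle_length :: "coloured_edge set \<Rightarrow> nat" where
  "cycle_length C = card {e \<in> C. fst e = Black}"

definition num_cycles :: "coloured_edge set \<Rightarrow> nat" where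
  "num_cycles E = card (alternating_cycles E)"

definition num_1_cycles :: "coloured_edge set \<Rightarrow> nat" where
  "num_1_cycles E = card {C \<in> alternating_cycles E. cycle_length C = 1}"

lemma prefix_reversal_append:
  "length xs = j \<Longrightarrow> prefix_reversal j (xs @ ys) = map uminus (rev xs) @ ys"
  by (simp add: prefix_reversal_def)

lemma sortable_prefix:
  assumes "signed_permutation m xs"
  shows "\<exists>js. set js \<subseteq> {1..m} \<and> fold prefix_reversal js (xs @ ys) = [1..int m] @ ys"
  using assms
proof (induction m arbitrary: xs ys)
  case 0
  then show ?case by (intro exI[of _ "[]"]) (simp add: signed_permutation_def)
next
  case (Suc m)
  have xs: "length xs = Suc m" "distinct (map abs xs)" "set (map abs xs) = {1..int (Suc m)}"
    using Suc.prems by (auto simp: signed_permutation_def)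
  have "int (Suc m) \<in> set (map abs xs)" unfolding xs(3) by simp
  then obtain x where x: "x \<in> set xs" "\<bar>x\<bar> = int (Suc m)" by auto
  then obtain as bs where ab: "xs = as @ x # bs" by (meson split_list)
  define zs where "zs = map uminus (rev as) @ bs"
  define ws where "ws = map uminus (rev zs)"
  have lz: "length zs = m" using xs(1) ab by (simp add: zs_def)
  have "set (map abs xs) = insert (int (Suc m)) (abs ` (set as \<union> set bs))"
    using ab x(2) by auto
  moreover have "int (Suc m) \<notin> abs ` (set as \<union> set bs)"
    using xs(2) unfolding ab distinct_map using x(2) by (auto simp: inj_on_def)
  ultimately have "abs ` (set as \<union> set bs) = {1..int (Suc m)} - {int (Suc m)}"
    using xs(3) by (metis Diff_insert_absorb)
  also have "\<dots> = {1..int m}" by auto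
  finally have S: "abs ` (set as \<union> set bs) = {1..int m}" .
  have sw: "set (map abs ws) = {1..int m}"
    using S by (simp add: ws_def zs_def image_Un image_image Un_commute)
  have lw: "length ws = m" by (simp add: ws_def lz)
  have dw: "distinct (map abs ws)"
    by (rule card_distinct, subst sw) (simp add: lw)
  have "signed_permutation m ws"
    using sw lw dw by (simp add: signed_permutation_def)
  from Suc.IH[OF this, of "int (Suc m) # ys"] obtain js where js: "set js \<subseteq> {1..m}"
    "fold prefix_reversal js (ws @ int (Suc m) # ys) = [1..int m] @ int (Suc m) # ys" by blast
  define fs :: "nat list" where "fs = (if x > 0 then [] else [1])"
  have 1: "prefix_reversal (Suc (length as)) (xs @ ys) = (- x) # zs @ ys"
    unfolding ab by (simp add: prefix_reversal_def zs_def)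
  have 2: "fold prefix_reversal fs ((- x) # zs @ ys) = (- int (Suc m)) # zs @ ys"
    using x(2) by (auto simp: fs_def prefix_reversal_def abs_if split: if_splits)
  have 3: "prefix_reversal (Suc m) ((- int (Suc m)) # zs @ ys) = ws @ int (Suc m) # ys"
    using prefix_reversal_append[of "(- int (Suc m)) # zs" "Suc m" ys] lz by (simp add: ws_def)
  have "fold prefix_reversal (Suc (length as) # fs @ Suc m # js) (xs @ ys) =
      [1..int m] @ int (Suc m) # ys"
    by (simp only: fold_simps fold_append comp_apply 1 2 3 js(2))
  moreover have "[1..int m] @ int (Suc m) # ys = [1..int (Suc m)] @ ys"
    using upto_rec2[of 1 "int (Suc m)"] by simp
  moreover have "set (Suc (length as) # fs @ Suc m # js) \<subseteq> {1..Suc m}"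
    using js(1) xs(1) ab by (auto simp: fs_def)
  ultimately show ?case by metis
qed

lemma signed_permutation_sortable:
  assumes "signed_permutation n \<pi>"
  shows "\<exists>js. set js \<subseteq> {1..length \<pi>} \<and> fold prefix_reversal js \<pi> = [1..int (length \<pi>)]"
  using sortable_prefix[OF assms, of "[]"] assms by (simp add: signed_permutation_def)

end

theory Submission
  imports Defs
begin

text \<open>
  Give each cycle of \<open>BG(\<pi>)\<close> the weight \<open>-1\<close> if it has length \<open>1\<close> and \<open>+1\<close> otherwise, and let the
  potential of \<open>\<pi>\<close> be the sum of the weights, minus \<open>2\<close> unless the cycle through position \<open>0\<close> has
  length \<open>1\<close>, which means \<open>\<pi>\<^sub>1 = 1\<close>. The identity has potential \<open>-(n + 1)\<close>, so it suffices
  that a prefix reversal lowers the potential by at most one.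

  After conjugation with the reflection of the positions \<open>1, \<dots>, 2j\<close>, the reversal of the prefix of
  length \<open>j\<close> keeps the grey edges and replaces the black edges \<open>{0, 1}\<close>, \<open>{2j, 2j+1}\<close> by
  \<open>{0, 2j}\<close>, \<open>{1, 2j+1}\<close>. Without these edges the graph has exactly four vertices of degree one, and
  each component contains an even number of them. Hence the move merges two cycles, splits a cycle, or
  keeps the partition into cycles. Since one of the affected cycles passes through position \<open>0\<close>,
  splitting off two cycles of length \<open>1\<close> costs \<open>3\<close> in weight but regains \<open>2\<close> from the correction term,
  and merging the cycle of length \<open>1\<close> through \<open>0\<close> loses the correction but not the weight.
\<close>

section \<open>Components of a symmetric relation\<close>

text \<open>For a symmetric \<open>E\<close> inside \<open>V \<times> V\<close> this is the
  partition of \<open>V\<close> into connected components. Components are kept as bare vertex sets,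
  so relations with different edges can have equal \<open>comps\<close>.\<close>

definition comps :: "('a \<times> 'a) set \<Rightarrow> 'a set \<Rightarrow> 'a set set" where
  "comps E V = (\<lambda>x. E\<^sup>* `` {x}) ` V"

lemma component_eqI:
  assumes "x \<in> X" "E `` X \<subseteq> X" "\<And>y. y \<in> X \<Longrightarrow> (x, y) \<in> E\<^sup>*"
  shows "E\<^sup>* `` {x} = X"
proof
  have "E\<^sup>* `` X = X" using assms(2) by (rule Image_closed_trancl)
  then show "E\<^sup>* `` {x} \<subseteq> X" using assms(1) by blast
  show "X \<subseteq> E\<^sup>* `` {x}" using assms(3) by auto
qed

text \<open>A closed and internally connected set is everything reachable from any of its points. A
  conjectured partition can therefore be checked block by block.\<close>

lemma comps_eqI:
  assumes "\<Union>P = V" "\<And>X. X \<in> P \<Longrightarrow> X \<noteq> {}" "\<And>X. X \<in> P \<Longrightarrow> E `` X \<subseteq> X"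
    "\<And>X x y. X \<in> P \<Longrightarrow> x \<in> X \<Longrightarrow> y \<in> X \<Longrightarrow> (x, y) \<in> E\<^sup>*"
  shows "comps E V = P"
proof -
  have c: "E\<^sup>* `` {x} = X" if "X \<in> P" "x \<in> X" for X x
    using that assms(3,4) by (intro component_eqI) auto
  show ?thesis
  proof
    show "comps E V \<subseteq> P" unfolding comps_def using c assms(1) by fastforce
    show "P \<subseteq> comps E V"
    proof
      fix X assume X: "X \<in> P"
      then obtain x where "x \<in> X" using assms(2) by blast
      then show "X \<in> comps E V" unfolding comps_def using c[OF X] assms(1) X by blast
    qed
  qed
qed

lemma component_mem_comps:
  assumes "sym E" "Z \<in> comps E V" "x \<in> Z"
  shows "E\<^sup>* `` {x} = Z"
proof -
  obtain z where z: "Z = E\<^sup>* `` {z}" using assms(2) by (auto simp: comps_def)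
  have "sym (E\<^sup>*)" using assms(1) by (rule sym_rtrancl)
  with assms(3) show ?thesis unfolding z by (auto dest: symD intro: rtrancl_trans)
qed

lemma comps_disjoint:
  assumes "sym E" "X \<in> comps E V" "Y \<in> comps E V" "X \<noteq> Y"
  shows "X \<inter> Y = {}"
proof (rule ccontr)
  assume "X \<inter> Y \<noteq> {}"
  then obtain x where x: "x \<in> X" "x \<in> Y" by blast
  show False
    using component_mem_comps[OF assms(1,2) x(1)] component_mem_comps[OF assms(1,3) x(2)] assms(4)
    by simp
qed

lemma comps_connected:
  assumes "sym E" "X \<in> comps E V" "x \<in> X" "y \<in> X"
  shows "(x, y) \<in> E\<^sup>*"
  using component_mem_comps[OF assms(1-3)] assms(4) by auto

lemma comps_closed:
  assumes "X \<in> comps E V"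
  shows "E `` X \<subseteq> X"
  using assms by (auto simp: comps_def intro: rtrancl_into_rtrancl)

lemma comps_nonempty: "X \<in> comps E V \<Longrightarrow> X \<noteq> {}"
  by (auto simp: comps_def)

lemma Union_comps:
  assumes "E \<subseteq> V \<times> V"
  shows "\<Union>(comps E V) = V"
proof -
  have "E\<^sup>* `` V = V" using assms by (intro Image_closed_trancl) auto
  then show ?thesis by (auto simp: comps_def)
qed

lemma comps_image:
  assumes "inj_on h V" "E \<subseteq> V \<times> V" "sym E"
  shows "comps (map_prod h h ` E) (h ` V) = image h ` comps E V"
proof (rule comps_eqI)
  have U: "\<Union>(comps E V) = V" using assms(2) by (rule Union_comps)
  show "\<Union>(image h ` comps E V) = h ` V" using U by blast
  fix Z assume "Z \<in> image h ` comps E V"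
  then obtain X where X: "X \<in> comps E V" "Z = h ` X" by auto
  show "Z \<noteq> {}" using comps_nonempty[OF X(1)] X(2) by simp
  have XV: "X \<subseteq> V" using U X(1) by blast
  show "(map_prod h h ` E) `` Z \<subseteq> Z"
  proof
    fix z assume "z \<in> (map_prod h h ` E) `` Z"
    then obtain x p q where *: "x \<in> X" "(p, q) \<in> E" "h p = h x" "z = h q" using X(2) by auto
    then have "p = x" using assms(1,2) XV by (auto simp: inj_on_def)
    then have "q \<in> X" using comps_closed[OF X(1)] * by blast
    then show "z \<in> Z" using * X(2) by blast
  qed
  fix x y assume "x \<in> Z" "y \<in> Z"
  then obtain p q where pq: "p \<in> X" "q \<in> X" "x = h p" "y = h q" using X(2) by auto
  have "(p, q) \<in> E\<^sup>*" using comps_connected[OF assms(3) X(1)] pq by blast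
  then have "(h p, h q) \<in> (map_prod h h ` E)\<^sup>*"
  proof (induction rule: rtrancl_induct)
    case (step y z)
    then have "(h y, h z) \<in> map_prod h h ` E" by force
    with step.IH show ?case by (rule rtrancl_into_rtrancl)
  qed simp
  then show "(x, y) \<in> (map_prod h h ` E)\<^sup>*" using pq by simp
qed

section \<open>Adding two edges to a relation\<close>

definition two_links :: "'a \<Rightarrow> 'a \<Rightarrow> 'a \<Rightarrow> 'a \<Rightarrow> ('a \<times> 'a) set" where
  "two_links a b c d = {(a, b), (b, a), (c, d), (d, c)}"

text \<open>An edge with both ends in one block connects nothing new. \<open>X\<close> and
  \<open>Y\<close> may coincide, which covers four ends in a single block.\<close>

lemma comps_two_links_within:
  assumes "sym A" "A \<subseteq> V \<times> V" "X \<in> comps A V" "Y \<in> comps A V"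
    "a \<in> X" "b \<in> X" "c \<in> Y" "d \<in> Y"
  shows "comps (A \<union> two_links a b c d) V = comps A V"
proof (rule comps_eqI)
  show "\<Union>(comps A V) = V" using assms(2) by (rule Union_comps)
  fix Z assume Z: "Z \<in> comps A V"
  show "Z \<noteq> {}" using Z by (rule comps_nonempty)
  have "X = Z \<or> X \<inter> Z = {}" "Y = Z \<or> Y \<inter> Z = {}"
    using comps_disjoint[OF assms(1)] assms(3,4) Z by blast+
  then show "(A \<union> two_links a b c d) `` Z \<subseteq> Z"
    using comps_closed[OF Z] assms(5-8) unfolding two_links_def by blast
  fix x y assume "x \<in> Z" "y \<in> Z"
  then have "(x, y) \<in> A\<^sup>*" by (rule comps_connected[OF assms(1) Z])
  then show "(x, y) \<in> (A \<union> two_links a b c d)\<^sup>*" using rtrancl_mono[of A] by blast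
qed

text \<open>Both edges run between \<open>X\<close> and \<open>Y\<close>, so these two blocks fuse
  and all others stay. The disjunction leaves the orientation of the second edge open; both
  orientations occur below.\<close>

lemma comps_two_links_across:
  assumes "sym A" "A \<subseteq> V \<times> V" "X \<in> comps A V" "Y \<in> comps A V"
    "a \<in> X" "b \<in> Y" "c \<in> X \<and> d \<in> Y \<or> c \<in> Y \<and> d \<in> X"
  shows "comps (A \<union> two_links a b c d) V = insert (X \<union> Y) (comps A V - {X, Y})"
proof (rule comps_eqI)
  let ?E = "A \<union> two_links a b c d"
  have U: "\<Union>(comps A V) = V" using assms(2) by (rule Union_comps)
  show "\<Union>(insert (X \<union> Y) (comps A V - {X, Y})) = V" using assms(3,4) U by blast
  have A: "A\<^sup>* \<subseteq> ?E\<^sup>*" by (rule rtrancl_mono) simp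
  fix Z assume Z: "Z \<in> insert (X \<union> Y) (comps A V - {X, Y})"
  show "Z \<noteq> {}" using Z comps_nonempty assms(3) by blast
  show "?E `` Z \<subseteq> Z"
  proof (cases "Z = X \<union> Y")
    case True
    then show ?thesis using comps_closed[OF assms(3)] comps_closed[OF assms(4)] assms(5-7)
      unfolding two_links_def by blast
  next
    case False
    with Z have Z: "Z \<in> comps A V" "Z \<noteq> X" "Z \<noteq> Y" by auto
    then have "X \<inter> Z = {}" "Y \<inter> Z = {}"
      using comps_disjoint[OF assms(1)] assms(3,4) by blast+
    then show ?thesis using comps_closed[OF Z(1)] assms(5-7) unfolding two_links_def by blast
  qed
  fix x y assume xy: "x \<in> Z" "y \<in> Z"
  show "(x, y) \<in> ?E\<^sup>*"
  proof (cases "Z = X \<union> Y")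
    case True
    have ab: "(a, b) \<in> ?E\<^sup>*" "(b, a) \<in> ?E\<^sup>*" by (auto simp: two_links_def)
    have "(x, a) \<in> ?E\<^sup>*" if "x \<in> X \<union> Y" for x
      using that comps_connected[OF assms(1,3) _ assms(5)] comps_connected[OF assms(1,4) _ assms(6)]
        A ab by (blast intro: rtrancl_trans)
    moreover have "(a, y) \<in> ?E\<^sup>*" if "y \<in> X \<union> Y" for y
      using that comps_connected[OF assms(1,3,5)] comps_connected[OF assms(1,4,6)]
        A ab by (blast intro: rtrancl_trans)
    ultimately show ?thesis using xy True by (blast intro: rtrancl_trans)
  next
    case False
    with Z have "Z \<in> comps A V" by auto
    then show ?thesis using comps_connected[OF assms(1)] xy A by blast
  qed
qed

section \<open>Fixed-point-free involutions\<close>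

text \<open>A perfect matching of \<open>V\<close>, given by the map from each vertex to its mate.
  Values outside \<open>V\<close> are unconstrained, so the same function can be restricted to
  components.\<close>

definition fpf_involution :: "'a set \<Rightarrow> ('a \<Rightarrow> 'a) \<Rightarrow> bool" where
  "fpf_involution V f \<longleftrightarrow> (\<forall>x\<in>V. f x \<in> V \<and> f x \<noteq> x \<and> f (f x) = x)"

text \<open>The pairs \<open>{x, f x}\<close> partition \<open>X\<close> into sets of size two. This
  yields parity arguments and, for the black matching, relates vertices of a cycle to its
  length.\<close>

lemma card_fpf_involution:
  assumes "finite X" "fpf_involution X f"
  shows "card X = 2 * card ((\<lambda>x. {x, f x}) ` X)"
proof -
  let ?F = "(\<lambda>x. {x, f x}) ` X"
  have "2 * card ?F = card (\<Union>?F)"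
  proof (rule card_partition)
    show "card c = 2" if "c \<in> ?F" for c
      using that assms(2) by (auto simp: fpf_involution_def card_insert_if)
    show "c1 \<inter> c2 = {}" if c: "c1 \<in> ?F" "c2 \<in> ?F" "c1 \<noteq> c2" for c1 c2
    proof (rule ccontr)
      assume "c1 \<inter> c2 \<noteq> {}"
      then obtain z where z: "z \<in> c1" "z \<in> c2" by blast
      have "e = {z, f z}" if "e \<in> ?F" "z \<in> e" for e
        using that assms(2) by (auto simp: fpf_involution_def)
      then show False using z c by metis
    qed
  qed (use assms(1) in auto)
  also have "\<Union>?F = X" using assms(2) unfolding fpf_involution_def by blast
  finally show ?thesis by simp
qed

definition links :: "'a set \<Rightarrow> ('a \<Rightarrow> 'a) \<Rightarrow> ('a \<times> 'a) set" where
  "links V f = (\<lambda>x. (x, f x)) ` V"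

lemma sym_links: "fpf_involution V f \<Longrightarrow> sym (links V f)"
  by (force simp: fpf_involution_def links_def sym_def)

lemma links_subset: "fpf_involution V f \<Longrightarrow> links V f \<subseteq> V \<times> V"
  by (auto simp: fpf_involution_def links_def)

lemma fpf_involution_closed_subset:
  "fpf_involution V f \<Longrightarrow> X \<subseteq> V \<Longrightarrow> links V f `` X \<subseteq> X \<Longrightarrow> fpf_involution X f"
  unfolding fpf_involution_def links_def by blast

lemma fpf_component:
  assumes "fpf_involution V b" "fpf_involution V g" "X \<in> comps (links V b \<union> links V g) V"
  shows "X \<subseteq> V" "fpf_involution X b" "fpf_involution X g"
proof -
  show X: "X \<subseteq> V"
    using Union_comps[of "links V b \<union> links V g" V] links_subset assms by blast
  show "fpf_involution X b" "fpf_involution X g"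
    using fpf_involution_closed_subset[OF assms(1) X] fpf_involution_closed_subset[OF assms(2) X]
      comps_closed[OF assms(3)] by (simp_all add: Un_Image)
qed

section \<open>The potential and its change under a two-break\<close>

text \<open>A cycle has twice as many vertices as black edges, so \<open>card X = 2\<close> marks
  length 1 and the sum is the number of cycles minus twice the number of 1-cycles. For
  \<open>a\<close> in \<open>V\<close> and symmetric \<open>E\<close>, the component of
  \<open>a\<close> together with the correction always contributes -1, whatever its size.\<close>

definition potential :: "('a \<times> 'a) set \<Rightarrow> 'a set \<Rightarrow> 'a \<Rightarrow> int" where
  "potential E V a = (\<Sum>X\<in>comps E V. if card X = 2 then -1 else 1)
     - (if card (E\<^sup>* `` {a}) = 2 then 0 else 2)"

text \<open>The common remainder \<open>s\<close> cancels when the split and the merged partition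
  are compared. That \<open>X \<union> Y\<close> is not already a block ensures that the insertion
  adds a new summand.\<close>

lemma potential_split:
  assumes "finite V" "sym A" "A \<subseteq> V \<times> V" "X \<in> comps A V" "Y \<in> comps A V" "X \<noteq> Y"
    "X \<union> Y \<notin> comps A V"
  defines "w \<equiv> (\<lambda>Z :: 'a set. if card Z = 2 then -1 else 1 :: int)"
  obtains s where
    "sum w (comps A V) = s + w X + w Y"
    "sum w (insert (X \<union> Y) (comps A V - {X, Y})) = s + w (X \<union> Y)"
proof
  have f: "finite (comps A V)" using assms(1) by (simp add: comps_def)
  let ?s = "sum w (comps A V - {X, Y})"
  have "comps A V = insert X (insert Y (comps A V - {X, Y}))" using assms(4,5) by blast
  then have "sum w (comps A V) = sum w (insert X (insert Y (comps A V - {X, Y})))" by simp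
  also have "\<dots> = ?s + w X + w Y" using f assms(6) by (simp del: insert_Diff_single)
  finally show "sum w (comps A V) = ?s + w X + w Y" .
  show "sum w (insert (X \<union> Y) (comps A V - {X, Y})) = ?s + w (X \<union> Y)"
    using f assms(7) by simp
qed

text \<open>By parity the four ends lie in one block of \<open>A\<close> or two by two in blocks
  \<open>X\<close> and \<open>Y\<close>. The block of \<open>a\<close> counts -1 with its correction
  before and after, so a merge or split changes the potential only by the weight of
  \<open>Y\<close>, which is 1 or -1.\<close>

lemma potential_two_break_classes:
  assumes fin: "finite V" and A: "sym A" "A \<subseteq> V \<times> V" and d: "distinct [a, b, c, d]"
    and V: "{a, b, c, d} \<subseteq> V"
    and even: "\<And>X. X \<in> comps A V \<Longrightarrow> even (card (X \<inter> {a, b, c, d}))"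
  shows "potential (A \<union> two_links a b c d) V a \<le> potential (A \<union> two_links a c b d) V a + 1"
proof -
  define w where "w = (\<lambda>Z :: 'a set. if card Z = 2 then -1 else 1 :: int)"
  let ?E = "A \<union> two_links a b c d" and ?F = "A \<union> two_links a c b d"
  define X where "X = A\<^sup>* `` {a}"
  have X: "X \<in> comps A V" "a \<in> X" using V by (auto simp: X_def comps_def)
  have EF: "sym ?E" "sym ?F" using A(1) by (auto simp: two_links_def sym_def)
  have U: "\<Union>(comps A V) = V" using A(2) by (rule Union_comps)
  have p: "potential E V a = sum w (comps E V) - (if card Z = 2 then 0 else 2)"
    if "sym E" "Z \<in> comps E V" "a \<in> Z" for E Z
    using component_mem_comps[OF that] by (simp add: potential_def w_def)
  \<comment> \<open>A merged block contains all four ends and hence is never a 1-cycle.\<close>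
  have big: "card Z \<noteq> 2" if "{a, b, c, d} \<subseteq> Z" "Z \<subseteq> V" for Z
  proof -
    have "card {a, b, c, d} = 4" using d by simp
    moreover have "card {a, b, c, d} \<le> card Z"
      using that fin by (intro card_mono) (auto intro: finite_subset)
    ultimately show ?thesis by simp
  qed
  show ?thesis
  proof (cases "{b, c, d} \<subseteq> X")
    case True
    then have "comps ?E V = comps A V" "comps ?F V = comps A V"
      using comps_two_links_within[OF A X(1) X(1)] X(2) by auto
    then show ?thesis using p[OF EF(1), of X] p[OF EF(2), of X] X by simp
  next
    case False
    \<comment> \<open>\<open>X\<close> contains \<open>a\<close> and an even number of the ends, but
      not all four, so exactly one of the others accompanies \<open>a\<close>.\<close>
    have one: "b \<in> X \<and> c \<notin> X \<and> d \<notin> X \<or> b \<notin> X \<and> c \<in> X \<and> d \<notin> X \<or> b \<notin> X \<and> c \<notin> X \<and> d \<in> X"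
    proof -
      have "even (card (X \<inter> {a, b, c, d}))" by (rule even[OF X(1)])
      then show ?thesis using False X(2) d
        by (cases "b \<in> X"; cases "c \<in> X"; cases "d \<in> X") auto
    qed
    then obtain y where y: "y \<in> {b, c, d}" "y \<notin> X" by blast
    define Y where "Y = A\<^sup>* `` {y}"
    have Y: "Y \<in> comps A V" "y \<in> Y" using y V by (auto simp: Y_def comps_def)
    have XY: "X \<noteq> Y" using Y y by blast
    have disj: "X \<inter> Y = {}" using comps_disjoint[OF A(1) X(1) Y(1) XY] .
    have "even (card (Y \<inter> {a, b, c, d}))" by (rule even[OF Y(1)])
    moreover have "a \<notin> Y" using disj X(2) by blast
    \<comment> \<open>\<open>Y\<close> contains one of the two remaining ends and an even number in
      total, hence both.\<close>
    ultimately have rest: "{b, c, d} - X \<subseteq> Y" using y Y(2) one disj d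
      by (cases "b \<in> Y"; cases "c \<in> Y"; cases "d \<in> Y") auto
    have cXY: "card (X \<union> Y) \<noteq> 2" using X Y U rest by (intro big) auto
    have "X \<union> Y \<notin> comps A V"
      using comps_disjoint[OF A(1) X(1), of "X \<union> Y"] XY X(2) disj Y(2) by blast
    then obtain s where s:
      "sum w (comps A V) = s + w X + w Y"
      "sum w (insert (X \<union> Y) (comps A V - {X, Y})) = s + w (X \<union> Y)"
      using potential_split[OF fin A X(1) Y(1) XY] unfolding w_def by metis
    note within = comps_two_links_within[OF A X(1) Y(1) X(2)]
    note across = comps_two_links_across[OF A X(1) Y(1) X(2)]
    \<comment> \<open>\<open>?E\<close> has the edges \<open>ab\<close>, \<open>cd\<close> and
      \<open>?F\<close> has \<open>ac\<close>, \<open>bd\<close>. If \<open>a\<close> is with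
      \<open>b\<close>, the move merges; if with \<open>c\<close>, it splits; if with
      \<open>d\<close>, both graphs join \<open>X\<close> to \<open>Y\<close> and have the same
      components.\<close>
    consider "b \<in> X" "c \<in> Y" "d \<in> Y" | "c \<in> X" "b \<in> Y" "d \<in> Y" | "d \<in> X" "b \<in> Y" "c \<in> Y"
      using one rest by blast
    then show ?thesis
    proof cases
      case 1
      then have "comps ?E V = comps A V" "comps ?F V = insert (X \<union> Y) (comps A V - {X, Y})"
        using within[of b c d] across[of c b d] by auto
      then show ?thesis using p[OF EF(1), of X] p[OF EF(2), of "X \<union> Y"] X s cXY
        by (auto simp: w_def)
    next
      case 2
      then have "comps ?F V = comps A V" "comps ?E V = insert (X \<union> Y) (comps A V - {X, Y})"
        using within[of c b d] across[of b c d] by auto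
      then show ?thesis using p[OF EF(2), of X] p[OF EF(1), of "X \<union> Y"] X s cXY
        by (auto simp: w_def)
    next
      case 3
      then have "comps ?F V = insert (X \<union> Y) (comps A V - {X, Y})"
          "comps ?E V = insert (X \<union> Y) (comps A V - {X, Y})"
        using across[of c b d] across[of b c d] by auto
      then show ?thesis using p[OF EF(2), of "X \<union> Y"] p[OF EF(1), of "X \<union> Y"] X by simp
    qed
  qed
qed

text \<open>Deleting the black edges at \<open>u\<close> and \<open>v\<close> leaves a relation
  \<open>A\<close> common to both graphs, each of which is \<open>A\<close> plus two edges. The
  conditions on \<open>v\<close> make the four ends distinct.\<close>

lemma potential_two_break:
  assumes fin: "finite V" and b: "fpf_involution V b" and g: "fpf_involution V g"
    and V: "u \<in> V" "v \<in> V" and uv: "v \<noteq> u" "v \<noteq> b u"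
    and b': "b' u = v" "b' v = u" "b' (b u) = b v" "b' (b v) = b u"
      "\<And>x. x \<in> V - {u, b u, v, b v} \<Longrightarrow> b' x = b x"
  shows "potential (links V b \<union> links V g) V u \<le> potential (links V b' \<union> links V g) V u + 1"
proof -
  define W where "W = {u, b u, v, b v}"
  define A where "A = links V g \<union> links (V - W) b"
  have bV: "b x \<in> V" "b x \<noteq> x" "b (b x) = x" if "x \<in> V" for x
    using b that by (auto simp: fpf_involution_def)
  have WV: "W \<subseteq> V" using V bV by (auto simp: W_def)
  have bW: "fpf_involution (V - W) b"
    using bV V unfolding fpf_involution_def W_def by (metis Diff_iff insert_iff empty_iff)
  have symA: "sym A" unfolding A_def using sym_links[OF g] sym_links[OF bW] by (rule sym_Un)
  have AV: "A \<subseteq> V \<times> V" unfolding A_def using links_subset[OF g] links_subset[OF bW] by blast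
  have V': "V = W \<union> (V - W)" using WV by blast
  have "links V b = links W b \<union> links (V - W) b"
    using V' unfolding links_def by (metis image_Un)
  also have "links W b = two_links u (b u) v (b v)"
    using V bV by (auto simp: W_def links_def two_links_def)
  finally have 1: "links V b \<union> links V g = A \<union> two_links u (b u) v (b v)"
    by (auto simp: A_def)
  have "links V b' = links W b' \<union> links (V - W) b'"
    using V' unfolding links_def by (metis image_Un)
  also have "links W b' = two_links u v (b u) (b v)"
    using b' by (auto simp: W_def links_def two_links_def)
  also have "links (V - W) b' = links (V - W) b"
    using b'(5) by (auto simp: links_def W_def)
  finally have 2: "links V b' \<union> links V g = A \<union> two_links u v (b u) (b v)"
    by (auto simp: A_def)
  \<comment> \<open>In \<open>A\<close> exactly the four vertices of \<open>W\<close> have degree one, so each component contains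
    an even number of them.\<close>
  have even: "even (card (X \<inter> {u, b u, v, b v}))" if X: "X \<in> comps A V" for X
  proof -
    have XV: "X \<subseteq> V" using Union_comps[OF AV] X by blast
    have c: "A `` X \<subseteq> X" using X by (rule comps_closed)
    have "fpf_involution X g"
      using fpf_involution_closed_subset[OF g XV] c by (simp add: A_def Un_Image)
    moreover have "links (V - W) b `` (X - W) \<subseteq> X - W"
      using c links_subset[OF bW] by (auto simp: A_def)
    then have "fpf_involution (X - W) b" using XV
      by (intro fpf_involution_closed_subset[OF bW]) auto
    moreover have fX: "finite X" using XV fin by (rule finite_subset)
    \<comment> \<open>Grey edges pair up \<open>X\<close>, and the surviving black edges pair up
      \<open>X - W\<close>; the number of ends in \<open>X\<close> is the difference of two even
      numbers.\<close>
    ultimately have "even (card X)" "even (card (X - W))"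
      using card_fpf_involution by (metis dvd_triv_left finite_Diff)+
    moreover have "card X = card (X \<inter> W) + card (X - W)"
      using fX by (metis card_Int_Diff)
    ultimately show ?thesis by (simp add: W_def)
  qed
  have "distinct [u, b u, v, b v]" using uv bV V by auto metis+
  moreover have "{u, b u, v, b v} \<subseteq> V" using WV by (simp add: W_def)
  ultimately show ?thesis unfolding 1 2
    using potential_two_break_classes[OF fin symA AV _ _ even] by blast
qed

text \<open>Renaming vertices injectively carries components to components of the same size. It will
  be applied to the reflection of positions.\<close>

lemma potential_image:
  assumes "inj_on h V" "E \<subseteq> V \<times> V" "sym E" "a \<in> V"
  shows "potential (map_prod h h ` E) (h ` V) (h a) = potential E V a"
proof -
  let ?F = "map_prod h h ` E"
  have XV: "X \<subseteq> V" if "X \<in> comps E V" for X using Union_comps[OF assms(2)] that by blast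
  have cd: "card (h ` X) = card X" if "X \<in> comps E V" for X
    using XV[OF that] assms(1) by (metis card_image inj_on_subset)
  have inj: "inj_on (image h) (comps E V)"
    using inj_on_image_Pow[OF assms(1)] XV by (meson PowI inj_on_subset subsetI)
  have symF: "sym ?F" using assms(3) by (force simp: sym_def)
  have Z: "E\<^sup>* `` {a} \<in> comps E V" "a \<in> E\<^sup>* `` {a}" using assms(4) by (auto simp: comps_def)
  then have "h ` (E\<^sup>* `` {a}) \<in> comps ?F (h ` V)"
    using comps_image[OF assms(1-3)] by blast
  then have "?F\<^sup>* `` {h a} = h ` (E\<^sup>* `` {a})"
    using component_mem_comps[OF symF] Z(2) by blast
  then show ?thesis
    using Z(1) by (simp add: potential_def comps_image[OF assms(1-3)] sum.reindex[OF inj] cd)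
qed

section \<open>Alternating cycles as components\<close>

text \<open>Every edge is generated from both of its ends. With one component in place of
  \<open>V\<close>, this is the edge set of a single cycle.\<close>

definition matching_edges :: "nat set \<Rightarrow> (nat \<Rightarrow> nat) \<Rightarrow> (nat \<Rightarrow> nat) \<Rightarrow> coloured_edge set" where
  "matching_edges V b g = (\<lambda>x. (Black, {x, b x})) ` V \<union> (\<lambda>x. (Grey, {x, g x})) ` V"

text \<open>Each vertex of the walk meets one black and one grey step, and these must be its edges
  in the two matchings. So the vertex set is closed under both matchings, and the walk itself
  connects it.\<close>

lemma closed_walk_edges_component:
  assumes b: "fpf_involution V b" and g: "fpf_involution V g"
    and vs: "vs \<noteq> []" "even (length vs)" "distinct vs"
      "closed_walk_edges vs \<subseteq> matching_edges V b g"
  shows "set vs \<in> comps (links V b \<union> links V g) V"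
    "closed_walk_edges vs = matching_edges (set vs) b g"
proof -
  define m where "m = length vs"
  have m: "even m" "0 < m" using vs by (auto simp: m_def)
  have e: "((if even i then Black else Grey), {vs ! i, vs ! (Suc i mod m)}) \<in> matching_edges V b g"
    if "i < m" for i
    using that vs(4) unfolding closed_walk_edges_def m_def by blast
  \<comment> \<open>Black steps start at even indices and \<open>m\<close> is even, so they never
    wrap around; only a grey step can close the walk.\<close>
  have bl: "vs ! i \<in> V" "vs ! Suc i = b (vs ! i)" "vs ! i = b (vs ! Suc i)" if "i < m" "even i" for i
  proof -
    have "Suc i < m" using that m by (metis Suc_lessI even_Suc)
    then have "(Black, {vs ! i, vs ! Suc i}) \<in> matching_edges V b g" using e[of i] that by simp
    then obtain x where "x \<in> V" "{vs ! i, vs ! Suc i} = {x, b x}"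
      by (auto simp: matching_edges_def)
    then show "vs ! i \<in> V" "vs ! Suc i = b (vs ! i)" "vs ! i = b (vs ! Suc i)"
      using b by (auto simp: fpf_involution_def doubleton_eq_iff)
  qed
  have gr: "vs ! i \<in> V" "vs ! (Suc i mod m) = g (vs ! i)" "vs ! i = g (vs ! (Suc i mod m))"
    if "i < m" "odd i" for i
  proof -
    have "(Grey, {vs ! i, vs ! (Suc i mod m)}) \<in> matching_edges V b g" using e[of i] that by simp
    then obtain x where "x \<in> V" "{vs ! i, vs ! (Suc i mod m)} = {x, g x}"
      by (auto simp: matching_edges_def)
    then show "vs ! i \<in> V" "vs ! (Suc i mod m) = g (vs ! i)" "vs ! i = g (vs ! (Suc i mod m))"
      using g by (auto simp: fpf_involution_def doubleton_eq_iff)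
  qed
  \<comment> \<open>Every even index is entered by a grey step, index 0 from the last index
    \<open>m - 1\<close>.\<close>
  have pred: "\<exists>k<m. odd k \<and> Suc k mod m = i" if "i < m" "even i" for i
  proof (cases i)
    case 0
    then show ?thesis using m by (intro exI[of _ "m - 1"]) auto
  next
    case (Suc k)
    then show ?thesis using that by (intro exI[of _ k]) auto
  qed
  have sV: "set vs \<subseteq> V" using bl(1) gr(1) by (metis in_set_conv_nth m_def subsetI)
  have eb: "\<exists>i<m. even i \<and> {x, b x} = {vs ! i, vs ! Suc i}" if x: "x \<in> set vs" for x
  proof -
    obtain i where i: "i < m" "x = vs ! i" using x by (auto simp: in_set_conv_nth m_def)
    show ?thesis
    proof (cases "even i")
      case True
      then show ?thesis using i bl(2) by (intro exI[of _ i]) auto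
    next
      case False
      then obtain k where k: "i = Suc k" by (metis even_zero not0_implies_Suc)
      then show ?thesis using i bl(3)[of k] False by (intro exI[of _ k]) auto
    qed
  qed
  have eg: "\<exists>i<m. odd i \<and> {x, g x} = {vs ! i, vs ! (Suc i mod m)}" if x: "x \<in> set vs" for x
  proof -
    obtain i where i: "i < m" "x = vs ! i" using x by (auto simp: in_set_conv_nth m_def)
    show ?thesis
    proof (cases "odd i")
      case True
      then show ?thesis using i gr(2) by (intro exI[of _ i]) auto
    next
      case False
      then obtain k where k: "k < m" "odd k" "Suc k mod m = i" using pred i by blast
      then show ?thesis using i gr(3)[of k] by (intro exI[of _ k]) auto
    qed
  qed
  have nx: "Suc i < m" if "i < m" "even i" for i
    using that m by (metis Suc_lessI even_Suc)
  have mem: "vs ! (i mod m) \<in> set vs" for i using m by (simp add: m_def)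
  have mem': "vs ! i \<in> set vs" if "i < m" for i using that by (simp add: m_def)
  have cb: "b x \<in> set vs" if x: "x \<in> set vs" for x
  proof -
    obtain i where "i < m" "even i" "{x, b x} = {vs ! i, vs ! Suc i}" using eb[OF x] by blast
    then show ?thesis using mem' nx by (metis doubleton_eq_iff)
  qed
  have cg: "g x \<in> set vs" if x: "x \<in> set vs" for x
  proof -
    obtain i where "i < m" "odd i" "{x, g x} = {vs ! i, vs ! (Suc i mod m)}" using eg[OF x] by blast
    then show ?thesis using mem mem' by (metis doubleton_eq_iff)
  qed
  let ?E = "links V b \<union> links V g"
  have reach: "(vs ! 0, vs ! i) \<in> ?E\<^sup>*" if "i < m" for i
    using that
  proof (induction i)
    case (Suc i)
    have "(vs ! i, vs ! Suc i) \<in> ?E"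
    proof (cases "even i")
      case True
      then show ?thesis using bl(1,2)[of i] Suc.prems by (auto simp: links_def)
    next
      case False
      then show ?thesis using gr(1,2)[of i] Suc.prems by (auto simp: links_def)
    qed
    with Suc show ?case by (meson Suc_lessD rtrancl.rtrancl_into_rtrancl)
  qed simp
  have "?E\<^sup>* `` {vs ! 0} = set vs"
  proof (rule component_eqI)
    show "vs ! 0 \<in> set vs" using mem' m(2) by blast
    show "?E `` set vs \<subseteq> set vs" using cb cg by (auto simp: links_def)
    show "(vs ! 0, y) \<in> ?E\<^sup>*" if "y \<in> set vs" for y
      using that reach by (auto simp: in_set_conv_nth m_def)
  qed
  then show "set vs \<in> comps ?E V" unfolding comps_def using sV mem' m(2) by blast
  show "closed_walk_edges vs = matching_edges (set vs) b g"
  proof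
    show "closed_walk_edges vs \<subseteq> matching_edges (set vs) b g"
    proof
      fix z assume "z \<in> closed_walk_edges vs"
      then obtain i where i: "i < m"
        "z = ((if even i then Black else Grey), {vs ! i, vs ! (Suc i mod m)})"
        unfolding closed_walk_edges_def m_def by blast
      show "z \<in> matching_edges (set vs) b g"
        using i bl(2)[of i] gr(2)[of i] mem'[of i] nx[of i] by (auto simp: matching_edges_def)
    qed
    show "matching_edges (set vs) b g \<subseteq> closed_walk_edges vs"
    proof
      fix z assume "z \<in> matching_edges (set vs) b g"
      then obtain x where x: "x \<in> set vs" "z = (Black, {x, b x}) \<or> z = (Grey, {x, g x})"
        by (auto simp: matching_edges_def)
      have "\<exists>i<m. z = ((if even i then Black else Grey), {vs ! i, vs ! (Suc i mod m)})"
        using x(2)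
      proof
        assume z: "z = (Black, {x, b x})"
        obtain i where "i < m" "even i" "{x, b x} = {vs ! i, vs ! Suc i}" using eb x(1) by blast
        then show ?thesis using z nx[of i] by (intro exI[of _ i]) auto
      next
        assume z: "z = (Grey, {x, g x})"
        obtain i where "i < m" "odd i" "{x, g x} = {vs ! i, vs ! (Suc i mod m)}"
          using eg x(1) by blast
        then show ?thesis using z by (intro exI[of _ i]) auto
      qed
      then show "z \<in> closed_walk_edges vs" unfolding closed_walk_edges_def m_def by blast
    qed
  qed
qed

section \<open>Closing an alternating walk\<close>

fun alternating_walk :: "('a \<Rightarrow> 'a) \<Rightarrow> ('a \<Rightarrow> 'a) \<Rightarrow> 'a \<Rightarrow> nat \<Rightarrow> 'a" where
  "alternating_walk b g x 0 = x"
| "alternating_walk b g x (Suc i) =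
     (if even i then b (alternating_walk b g x i) else g (alternating_walk b g x i))"

text \<open>In a finite \<open>V\<close> the alternating walk from \<open>x\<close> must repeat a
  vertex. Its first repetition is a return to \<open>x\<close> itself after an even number of steps,
  so cutting the walk there gives an alternating cycle.\<close>

lemma ex_closed_walk:
  assumes fin: "finite V" and b: "fpf_involution V b" and g: "fpf_involution V g" and x: "x \<in> V"
  obtains vs where "vs \<noteq> []" "even (length vs)" "distinct vs" "x \<in> set vs"
    "closed_walk_edges vs \<subseteq> matching_edges V b g"
proof -
  let ?u = "alternating_walk b g x"
  have uV: "?u i \<in> V" for i
    using x b g by (induction i) (auto simp: fpf_involution_def)
  have bb: "b (b y) = y" "b y \<noteq> y" and gg: "g (g y) = y" "g y \<noteq> y" if "y \<in> V" for y
    using that b g by (auto simp: fpf_involution_def)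
  have "\<not> inj ?u" using finite_subset[of "range ?u" V] uV fin finite_imageD[of ?u UNIV] by auto
  then have ex: "\<exists>t. \<exists>s<t. ?u s = ?u t" unfolding inj_def by (metis nat_neq_iff)
  define t where "t = (LEAST t. \<exists>s<t. ?u s = ?u t)"
  obtain s where s: "s < t" "?u s = ?u t" using LeastI_ex[OF ex] unfolding t_def by blast
  have min: "?u i \<noteq> ?u j" if "i < j" "j < t" for i j
    using not_less_Least[of j "\<lambda>t. \<exists>s<t. ?u s = ?u t"] that unfolding t_def by blast
  obtain r where r: "t = Suc r" using s(1) by (cases t) auto
  \<comment> \<open>A first return to an interior vertex would reuse one of its two edges, and the other end of
    that edge would have been revisited earlier.\<close>
  have nxt: "Suc s < r \<or> Suc s = t" if "odd s \<longleftrightarrow> odd r"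
  proof -
    have "\<not> odd (s + r)" "s \<le> r" using that s(1) r by auto
    then show ?thesis using r by (metis Suc_lessI add_Suc even_Suc even_add le_neq_implies_less)
  qed
  have s0: "s = 0 \<and> odd r"
  proof (cases "even r")
    case True
    then have t: "?u t = b (?u r)" by (simp add: r)
    show ?thesis
    proof (cases "even s")
      case True
      have *: "?u (Suc s) = ?u r" using s(2) t True bb(1)[OF uV] by simp
      have "Suc s < r \<or> Suc s = t" using nxt True \<open>even r\<close> by blast
      then show ?thesis using * min[of "Suc s" r] s r bb(2)[OF uV, of s] True by auto
    next
      case False
      then obtain k where k: "s = Suc k" "even k" by (cases s) auto
      \<comment> \<open>The steps into \<open>s\<close> and into \<open>t\<close> have the same
        colour, so their starting vertices already agree, before time \<open>t\<close>.\<close>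
      then have "?u k = ?u r" using s(2) t bb(1)[OF uV] by (metis alternating_walk.simps(2))
      then show ?thesis using min[of k r] k s(1) r by simp
    qed
  next
    case odd: False
    then have t: "?u t = g (?u r)" by (simp add: r)
    show ?thesis
    proof (cases "even s")
      case False
      have *: "?u (Suc s) = ?u r" using s(2) t False gg(1)[OF uV] by simp
      have "Suc s < r \<or> Suc s = t" using nxt False odd by blast
      then show ?thesis using * min[of "Suc s" r] s r gg(2)[OF uV, of s] False by auto
    next
      case True
      show ?thesis
      proof (cases s)
        case (Suc k)
        then have "odd k" using True by simp
        then have "?u k = ?u r" using s(2) t gg(1)[OF uV] Suc by (metis alternating_walk.simps(2))
        then show ?thesis using min[of k r] Suc s(1) r by simp
      qed (use odd in simp)
    qed
  qed
  define vs where "vs = map ?u [0..<t]"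
  have len: "length vs = t" by (simp add: vs_def)
  show ?thesis
  proof
    show "vs \<noteq> []" using r len by auto
    show "even (length vs)" using len r s0 by simp
    show "distinct vs" unfolding vs_def distinct_map
      using min by (auto simp: inj_on_def) (metis nat_neq_iff)
    show "x \<in> set vs" using r nth_mem[of 0 vs] by (simp add: vs_def del: upt_Suc)
    have nth: "vs ! i = ?u i" if "i < t" for i using that by (simp add: vs_def)
    have suc: "vs ! (Suc i mod t) = ?u (Suc i)" if "i < t" for i
    proof (cases "Suc i = t")
      case True
      then show ?thesis using s s0 nth[of 0] by auto
    next
      case False
      then show ?thesis using that nth by simp
    qed
    show "closed_walk_edges vs \<subseteq> matching_edges V b g"
      unfolding closed_walk_edges_def len
      using nth suc uV by (auto simp: matching_edges_def)
  qed
qed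

text \<open>Closed alternating walks trace out whole components. Conversely, the walk started in a
  component covers a component with a vertex in common, hence the same one.\<close>

lemma alternating_cycles_matching_edges:
  assumes fin: "finite V" and b: "fpf_involution V b" and g: "fpf_involution V g"
  shows "alternating_cycles (matching_edges V b g) =
    (\<lambda>X. matching_edges X b g) ` comps (links V b \<union> links V g) V" (is "?C = ?f ` ?P")
proof
  show "?C \<subseteq> ?f ` ?P"
    using closed_walk_edges_component[OF b g] by (auto simp: alternating_cycles_def)
  have symE: "sym (links V b \<union> links V g)"
    using sym_links[OF b] sym_links[OF g] by (rule sym_Un)
  show "?f ` ?P \<subseteq> ?C"
  proof
    fix C assume "C \<in> ?f ` ?P"
    then obtain X where X: "X \<in> ?P" "C = ?f X" by blast
    obtain x where x: "x \<in> X" "x \<in> V"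
      using comps_nonempty[OF X(1)] fpf_component(1)[OF b g X(1)] by blast
    obtain vs where vs: "vs \<noteq> []" "even (length vs)" "distinct vs" "x \<in> set vs"
      "closed_walk_edges vs \<subseteq> matching_edges V b g"
      using ex_closed_walk[OF fin b g x(2)] .
    note c = closed_walk_edges_component[OF b g vs(1-3,5)]
    have "set vs = X"
      using component_mem_comps[OF symE c(1) vs(4)] component_mem_comps[OF symE X(1) x(1)] by simp
    then show "C \<in> ?C" unfolding alternating_cycles_def using c(2) X(2) vs by blast
  qed
qed

lemma cycle_length_matching_edges:
  assumes "finite X" "fpf_involution X b"
  shows "card X = 2 * cycle_length (matching_edges X b g)"
proof -
  have "{e \<in> matching_edges X b g. fst e = Black} = Pair Black ` (\<lambda>x. {x, b x}) ` X"
    by (auto simp: matching_edges_def)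
  then show ?thesis unfolding cycle_length_def
    using card_fpf_involution[OF assms] by (simp add: card_image inj_on_def)
qed

lemma num_cycles_matching_edges:
  assumes fin: "finite V" and b: "fpf_involution V b" and g: "fpf_involution V g"
  shows "int (num_cycles (matching_edges V b g)) - 2 * int (num_1_cycles (matching_edges V b g)) =
    (\<Sum>X\<in>comps (links V b \<union> links V g) V. if card X = 2 then -1 else 1)"
proof -
  let ?P = "comps (links V b \<union> links V g) V" and ?f = "\<lambda>X. matching_edges X b g"
  note alt = alternating_cycles_matching_edges[OF assms]
  \<comment> \<open>The vertices of a cycle recover its component, so components and cycles
    correspond one to one.\<close>
  have verts: "\<Union>(snd ` ?f X) = X" if "X \<in> ?P" for X
    using fpf_component(2,3)[OF b g that] by (auto simp: matching_edges_def fpf_involution_def)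
  have inj: "inj_on ?f ?P" by (rule inj_on_inverseI[where g = "\<lambda>C. \<Union>(snd ` C)"]) (rule verts)
  have len: "cycle_length (?f X) = 1 \<longleftrightarrow> card X = 2" if "X \<in> ?P" for X
    using cycle_length_matching_edges[OF finite_subset[OF fpf_component(1)[OF b g that] fin]
        fpf_component(2)[OF b g that], of g] by simp
  have finP: "finite ?P" using fin by (simp add: comps_def)
  have n: "num_cycles (matching_edges V b g) = card ?P"
    unfolding num_cycles_def alt using inj by (rule card_image)
  have "{C \<in> ?f ` ?P. cycle_length C = 1} = ?f ` {X \<in> ?P. card X = 2}" using len by auto
  then have n1: "num_1_cycles (matching_edges V b g) = card {X \<in> ?P. card X = 2}"
    unfolding num_1_cycles_def alt
    by (simp add: card_image[OF inj_on_subset[OF inj]])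
  have "(\<Sum>X\<in>?P. if card X = 2 then -1 else 1 :: int) =
      (\<Sum>X\<in>?P. 1 - 2 * (if card X = 2 then 1 else 0))"
    by (rule sum.cong) auto
  also have "\<dots> = int (card ?P) - 2 * int (card {X \<in> ?P. card X = 2})"
    using finP by (simp add: sum_subtractf sum_distrib_left[symmetric] sum.If_cases Int_def)
  finally show ?thesis using n n1 by simp
qed

text \<open>The component contains \<open>x\<close>, \<open>b x\<close> and \<open>g x\<close>,
  where \<open>x\<close> differs from the other two. Size two forces these to coincide; if they do,
  \<open>{x, b x}\<close> is already closed.\<close>

lemma card_component_eq_2_iff:
  assumes fin: "finite V" and b: "fpf_involution V b" and g: "fpf_involution V g" and x: "x \<in> V"
  shows "card ((links V b \<union> links V g)\<^sup>* `` {x}) = 2 \<longleftrightarrow> g x = b x"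
proof -
  let ?E = "links V b \<union> links V g"
  let ?X = "?E\<^sup>* `` {x}"
  have X: "?X \<in> comps ?E V" "x \<in> ?X" using x by (auto simp: comps_def)
  note f = fpf_component[OF b g X(1)]
  have m: "{x, b x, g x} \<subseteq> ?X" "b x \<noteq> x" "g x \<noteq> x"
    using f(2,3) X(2) by (auto simp: fpf_involution_def)
  have fX: "finite ?X" using f(1) fin by (rule finite_subset)
  show ?thesis
  proof
    assume c: "card ?X = 2"
    have "card {x, b x, g x} \<le> 2" using card_mono[OF fX m(1)] c by simp
    then show "g x = b x" using m by (auto simp: card_insert_if split: if_splits)
  next
    assume eq: "g x = b x"
    have bb: "b (b x) = x" "g (b x) = x"
      using b g x eq unfolding fpf_involution_def by metis+
    have "?X = {x, b x}"
    proof (rule component_eqI)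
      show "?E `` {x, b x} \<subseteq> {x, b x}"
        using eq bb unfolding links_def by auto
      show "(x, y) \<in> ?E\<^sup>*" if "y \<in> {x, b x}" for y using that x by (auto simp: links_def)
    qed simp
    then show "card ?X = 2" using m(2) by simp
  qed
qed

section \<open>The breakpoint graph\<close>

text \<open>Pairs \<open>2k\<close> with \<open>2k + 1\<close>. Applied to positions it gives the
  black edges, applied to labels the grey ones.\<close>

definition partner :: "nat \<Rightarrow> nat" where
  "partner p = (if even p then p + 1 else p - 1)"

lemma partner_partner: "partner (partner p) = p"
  by (auto simp: partner_def)

lemma partner_less: "even N \<Longrightarrow> p < N \<Longrightarrow> partner p < N"
  by (auto simp: partner_def) (metis Suc_lessI even_Suc)

lemma fpf_involution_partner: "even N \<Longrightarrow> fpf_involution {..<N} partner"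
  by (auto simp: fpf_involution_def partner_partner partner_less)
    (auto simp: partner_def split: if_splits elim: oddE)

section \<open>Grey edges determined by the labels\<close>

definition labelling :: "nat \<Rightarrow> int list \<Rightarrow> bool" where
  "labelling N L \<longleftrightarrow> even N \<and> length L = N \<and> distinct L \<and> set L = {0..<int N}"

definition grey_partner :: "int list \<Rightarrow> nat \<Rightarrow> nat" where
  "grey_partner L p = inv_into {..<length L} (nth L) (int (partner (nat (L ! p))))"

lemma labelling_nth:
  assumes "labelling N L" "p < N"
  shows "0 \<le> L ! p" "L ! p < int N" "nat (L ! p) < N"
proof -
  have "L ! p \<in> {0..<int N}" using assms nth_mem by (metis labelling_def)
  then show "0 \<le> L ! p" "L ! p < int N" "nat (L ! p) < N" by auto
qed

lemma labelling_inj: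
  assumes "labelling N L" "p < N" "q < N" "L ! p = L ! q"
  shows "p = q"
  using assms nth_eq_iff_index_eq by (metis labelling_def)

lemma grey_partner_nth:
  assumes L: "labelling N L" and p: "p < N"
  shows "grey_partner L p < N" "L ! grey_partner L p = int (partner (nat (L ! p)))"
proof -
  have "partner (nat (L ! p)) < N"
    using L labelling_nth(3)[OF L p] by (intro partner_less) (auto simp: labelling_def)
  then have "int (partner (nat (L ! p))) \<in> set L" using L by (simp add: labelling_def)
  then have "int (partner (nat (L ! p))) \<in> nth L ` {..<length L}"
    by (metis in_set_conv_nth image_eqI lessThan_iff)
  then show "grey_partner L p < N" "L ! grey_partner L p = int (partner (nat (L ! p)))"
    using L inv_into_into[of _ "nth L" "{..<length L}"] f_inv_into_f[of _ "nth L" "{..<length L}"]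
    unfolding grey_partner_def labelling_def by auto
qed

lemma grey_partner_eqI:
  assumes "labelling N L" "p < N" "q < N" "L ! q = int (partner (nat (L ! p)))"
  shows "grey_partner L p = q"
  using labelling_inj[OF assms(1)] grey_partner_nth[OF assms(1,2)] assms(3,4) by simp

lemma fpf_involution_grey_partner:
  assumes L: "labelling N L"
  shows "fpf_involution {..<N} (grey_partner L)"
  unfolding fpf_involution_def
proof (intro ballI conjI)
  fix p assume "p \<in> {..<N}"
  then have p: "p < N" by simp
  note g = grey_partner_nth[OF L p]
  show "grey_partner L p \<in> {..<N}" using g by simp
  show "grey_partner L (grey_partner L p) = p"
    using labelling_nth[OF L p] g p by (intro grey_partner_eqI[OF L]) (auto simp: partner_partner)
  have "partner (nat (L ! p)) \<noteq> nat (L ! p)" by (auto simp: partner_def)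
  then show "grey_partner L p \<noteq> p" using g(2) by (metis nat_int)
qed

definition label_pair :: "int \<Rightarrow> int list" where
  "label_pair x = (if x > 0 then [2 * x - 1, 2 * x] else [2 * \<bar>x\<bar>, 2 * \<bar>x\<bar> - 1])"

lemma bg_labels_alt:
  "bg_labels \<pi> = 0 # concat (map label_pair \<pi>) @ [2 * int (length \<pi>) + 1]"
  by (simp add: bg_labels_def label_pair_def[abs_def])

lemma length_label_pairs: "length (concat (map label_pair xs)) = 2 * length xs"
  by (induction xs) (auto simp: label_pair_def)

text \<open>Whatever its sign, an entry \<open>x\<close> contributes the labels
  \<open>2 * \<bar>x\<bar> - 1\<close> and \<open>2 * \<bar>x\<bar>\<close>, and these pairs tile
  the range from 1 to \<open>2 * n\<close>.\<close>

lemma labelling_bg_labels: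
  assumes "signed_permutation n \<pi>"
  shows "labelling (2 * n + 2) (bg_labels \<pi>)"
proof -
  have len: "length \<pi> = n" and s: "abs ` set \<pi> = {1..int n}"
    using assms by (auto simp: signed_permutation_def)
  have l: "length (bg_labels \<pi>) = 2 * n + 2"
    by (simp add: bg_labels_alt length_label_pairs len)
  have "set (label_pair x) = {2 * \<bar>x\<bar> - 1, 2 * \<bar>x\<bar>}" for x
    by (auto simp: label_pair_def)
  then have "set (concat (map label_pair \<pi>)) = (\<Union>y \<in> abs ` set \<pi>. {2 * y - 1, 2 * y})" by auto
  also have "\<dots> = {1..2 * int n}"
  proof -
    have "z \<in> (\<Union>y \<in> {1..int n}. {2 * y - 1, 2 * y})" if "z \<in> {1..2 * int n}" for z
      using that by (intro UN_I[of "(z + 1) div 2"]) auto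
    then show ?thesis unfolding s by auto
  qed
  finally have "set (bg_labels \<pi>) = insert 0 (insert (2 * int n + 1) {1..2 * int n})"
    by (simp add: bg_labels_alt len)
  also have "\<dots> = {0..<int (2 * n + 2)}" by auto
  finally have set: "set (bg_labels \<pi>) = {0..<int (2 * n + 2)}" .
  \<comment> \<open>The list has as many entries as its set has elements.\<close>
  have "distinct (bg_labels \<pi>)" by (rule card_distinct) (simp only: set l, simp)
  with l set show ?thesis by (simp add: labelling_def)
qed

lemma breakpoint_graph_eq_matching_edges:
  assumes "signed_permutation n \<pi>"
  shows "breakpoint_graph \<pi> =
    matching_edges {..<2 * n + 2} partner (grey_partner (bg_labels \<pi>))"
proof -
  define L where "L = bg_labels \<pi>"
  let ?N = "2 * n + 2"
  have L: "labelling ?N L" unfolding L_def using assms by (rule labelling_bg_labels)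
  have len: "length \<pi> = n" "length L = ?N"
    using assms L by (auto simp: signed_permutation_def labelling_def)
  have black: "{(Black, {2 * i, 2 * i + 1}) | i. i \<le> n} = (\<lambda>x. (Black, {x, partner x})) ` {..<?N}"
  proof
    show "{(Black, {2 * i, 2 * i + 1}) | i. i \<le> n} \<subseteq> (\<lambda>x. (Black, {x, partner x})) ` {..<?N}"
    proof
      fix z assume "z \<in> {(Black, {2 * i, 2 * i + 1}) | i. i \<le> n}"
      then obtain i where "i \<le> n" "z = (Black, {2 * i, 2 * i + 1})" by blast
      then show "z \<in> (\<lambda>x. (Black, {x, partner x})) ` {..<?N}"
        by (intro image_eqI[of _ _ "2 * i"]) (auto simp: partner_def)
    qed
    show "(\<lambda>x. (Black, {x, partner x})) ` {..<?N} \<subseteq> {(Black, {2 * i, 2 * i + 1}) | i. i \<le> n}"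
    proof
      fix z assume "z \<in> (\<lambda>x. (Black, {x, partner x})) ` {..<?N}"
      then obtain x where x: "x < ?N" "z = (Black, {x, partner x})" by auto
      have "{x, partner x} = {2 * (x div 2), 2 * (x div 2) + 1}"
        by (cases "even x") (auto simp: partner_def elim!: evenE oddE)
      then show "z \<in> {(Black, {2 * i, 2 * i + 1}) | i. i \<le> n}" using x by auto
    qed
  qed
  have grey: "{(Grey, {p, q}) | p q k. p < ?N \<and> q < ?N \<and> k \<le> n \<and>
        L ! p = 2 * int k \<and> L ! q = 2 * int k + 1} = (\<lambda>x. (Grey, {x, grey_partner L x})) ` {..<?N}"
    (is "?A = ?B")
  proof
    show "?A \<subseteq> ?B"
    proof
      fix z assume "z \<in> ?A"
      then obtain p q k where *: "p < ?N" "q < ?N" "L ! p = 2 * int k" "L ! q = 2 * int k + 1"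
        "z = (Grey, {p, q})" by blast
      have "grey_partner L p = q"
        using * by (intro grey_partner_eqI[OF L]) (auto simp: partner_def nat_mult_distrib)
      then show "z \<in> ?B" using * by blast
    qed
    show "?B \<subseteq> ?A"
    proof
      fix z assume "z \<in> ?B"
      then obtain x where x: "x < ?N" "z = (Grey, {x, grey_partner L x})" by auto
      note g = grey_partner_nth[OF L x(1)] and l = labelling_nth[OF L x(1)]
      \<comment> \<open>The index of the grey edge at \<open>x\<close>; the parity of the label
        tells which of its two ends \<open>x\<close> is.\<close>
      define k where "k = nat (L ! x) div 2"
      have k: "k \<le> n" using l by (simp add: k_def)
      show "z \<in> ?A"
      proof (cases "even (nat (L ! x))")
        case True
        then have "nat (L ! x) = 2 * k" by (simp add: k_def)
        then have "L ! x = 2 * int k" "L ! grey_partner L x = 2 * int k + 1"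
          using l g(2) by (auto simp: partner_def)
        then show ?thesis using x g(1) k by blast
      next
        case False
        then have "nat (L ! x) = 2 * k + 1" by (simp add: k_def)
        then have "L ! x = 2 * int k + 1" "L ! grey_partner L x = 2 * int k"
          using l g(2) by (auto simp: partner_def)
        moreover have "z = (Grey, {grey_partner L x, x})" using x by auto
        ultimately show ?thesis using x g(1) k by blast
      qed
    qed
  qed
  show ?thesis
    unfolding breakpoint_graph_def matching_edges_def len(1) L_def[symmetric] len(2)
    using black grey by simp
qed

section \<open>Prefix reversals as two-breaks\<close>

text \<open>With \<open>m = 2 * j\<close> this reverses the positions occupied by the first
  \<open>j\<close> entries and fixes position 0 and everything behind the block.\<close>

definition reflect :: "nat \<Rightarrow> nat \<Rightarrow> nat" where
  "reflect m p = (if 1 \<le> p \<and> p \<le> m then m + 1 - p else p)"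

lemma reflect_reflect: "reflect m (reflect m p) = p"
  by (auto simp: reflect_def)

text \<open>Negating a nonzero entry swaps its two labels, so a signed reversal acts on the labels
  as a plain reversal. The entry 0 would break this, since negation leaves its pair as it
  is.\<close>

lemma concat_label_pair_reversed:
  "0 \<notin> set xs \<Longrightarrow>
    concat (map label_pair (map uminus (rev xs))) = rev (concat (map label_pair xs))"
  by (induction xs) (auto simp: label_pair_def)

lemma bg_labels_prefix_reversal_nth:
  assumes "0 \<notin> set \<pi>" "j \<le> length \<pi>" "p < 2 * length \<pi> + 2"
  shows "bg_labels (prefix_reversal j \<pi>) ! p = bg_labels \<pi> ! reflect (2 * j) p"
proof -
  let ?c = "\<lambda>xs. concat (map label_pair xs)"
  define P Q where "P = ?c (take j \<pi>)" and "Q = ?c (drop j \<pi>) @ [2 * int (length \<pi>) + 1]"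
  have P: "length P = 2 * j" using assms(2) by (simp add: P_def length_label_pairs)
  have "?c \<pi> = ?c (take j \<pi>) @ ?c (drop j \<pi>)"
    by (metis append_take_drop_id concat_append map_append)
  then have 1: "bg_labels \<pi> = 0 # P @ Q" by (simp add: bg_labels_alt P_def Q_def)
  have "0 \<notin> set (take j \<pi>)" using assms(1) in_set_takeD by metis
  from concat_label_pair_reversed[OF this]
  have 2: "bg_labels (prefix_reversal j \<pi>) = 0 # rev P @ Q"
    using assms(2) by (simp add: bg_labels_alt prefix_reversal_def P_def Q_def)
  show ?thesis unfolding 1 2
    by (cases p) (auto simp: reflect_def nth_append rev_nth P)
qed

lemma signed_permutation_prefix_reversal:
  assumes "signed_permutation n \<pi>"
  shows "signed_permutation n (prefix_reversal j \<pi>)"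
proof -
  have "map abs (prefix_reversal j \<pi>) = rev (take j (map abs \<pi>)) @ drop j (map abs \<pi>)"
    by (simp add: prefix_reversal_def rev_map take_map drop_map comp_def)
  moreover have "set (rev xs @ ys) = set (xs @ ys)" "distinct (rev xs @ ys) = distinct (xs @ ys)"
    "length (rev xs @ ys) = length (xs @ ys)" for xs ys :: "int list" by auto
  ultimately show ?thesis using assms
    by (metis append_take_drop_id length_map signed_permutation_def)
qed

definition bg_potential :: "int list \<Rightarrow> int" where
  "bg_potential \<pi> = (let V = {..<2 * length \<pi> + 2} in
     potential (links V partner \<union> links V (grey_partner (bg_labels \<pi>))) V 0)"

lemma links_conjugate:
  assumes "\<And>x. x \<in> V \<Longrightarrow> s x \<in> V" "\<And>x. s (s x) = x"
  shows "map_prod s s ` links V f = links V (\<lambda>x. s (f (s x)))"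
proof -
  have "s ` V = V" using assms by (metis image_subsetI subset_antisym image_eqI subsetI)
  then have "links V (\<lambda>x. s (f (s x))) = (\<lambda>x. (x, s (f (s x)))) ` s ` V" by (simp add: links_def)
  also have "\<dots> = map_prod s s ` links V f" by (simp add: links_def image_image assms(2))
  finally show ?thesis by simp
qed

lemma bg_potential_prefix_reversal:
  assumes \<pi>: "signed_permutation n \<pi>" and j: "1 \<le> j" "j \<le> n"
  shows "bg_potential \<pi> \<le> bg_potential (prefix_reversal j \<pi>) + 1"
proof -
  define V where "V = {..<2 * n + 2}"
  define \<pi>' where "\<pi>' = prefix_reversal j \<pi>"
  have \<pi>': "signed_permutation n \<pi>'"
    unfolding \<pi>'_def using \<pi> by (rule signed_permutation_prefix_reversal)
  have len: "length \<pi> = n" "length \<pi>' = n" using \<pi> \<pi>' by (auto simp: signed_permutation_def)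
  define \<gamma> \<gamma>' where "\<gamma> = grey_partner (bg_labels \<pi>)" and "\<gamma>' = grey_partner (bg_labels \<pi>')"
  let ?s = "reflect (2 * j)"
  note L = labelling_bg_labels[OF \<pi>] and L' = labelling_bg_labels[OF \<pi>']
  have fp: "fpf_involution V partner" unfolding V_def by (rule fpf_involution_partner) simp
  have fg: "fpf_involution V \<gamma>" "fpf_involution V \<gamma>'"
    unfolding V_def \<gamma>_def \<gamma>'_def using L L' by (auto intro: fpf_involution_grey_partner)
  have sV: "?s p \<in> V" if "p \<in> V" for p using that j by (auto simp: V_def reflect_def)
  have "0 \<notin> abs ` set \<pi>" using \<pi> by (simp add: signed_permutation_def)
  then have "0 \<notin> set \<pi>" by force
  then have nth: "bg_labels \<pi>' ! p = bg_labels \<pi> ! ?s p" if "p \<in> V" for p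
    unfolding \<pi>'_def using that j len by (intro bg_labels_prefix_reversal_nth) (auto simp: V_def)
  \<comment> \<open>Labels travel with the reflection, and grey edges depend only on labels. Read in
    the reflected positions, the grey matching is the old one.\<close>
  have conj: "?s (\<gamma>' (?s p)) = \<gamma> p" if p: "p \<in> V" for p
  proof -
    have "\<gamma> p \<in> V" using fg(1) p by (auto simp: fpf_involution_def)
    moreover have "bg_labels \<pi> ! \<gamma> p = int (partner (nat (bg_labels \<pi> ! p)))"
      unfolding \<gamma>_def using p by (intro grey_partner_nth(2)[OF L]) (simp add: V_def)
    ultimately have "\<gamma>' (?s p) = ?s (\<gamma> p)"
      unfolding \<gamma>'_def using p sV nth
      by (intro grey_partner_eqI[OF L']) (auto simp: reflect_reflect V_def)
    then show ?thesis by (simp add: reflect_reflect)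
  qed
  let ?E = "links V partner \<union> links V \<gamma>'"
  have E: "?E \<subseteq> V \<times> V" "sym ?E"
    using links_subset[OF fp] links_subset[OF fg(2)] sym_links[OF fp] sym_links[OF fg(2)]
    by (auto intro: sym_Un)
  have im: "?s ` V = V"
    using sV reflect_reflect by (metis image_subsetI subset_antisym image_eqI subsetI)
  have "map_prod ?s ?s ` ?E = links V (\<lambda>x. ?s (partner (?s x))) \<union> links V (\<lambda>x. ?s (\<gamma>' (?s x)))"
    by (simp add: image_Un links_conjugate sV reflect_reflect)
  also have "links V (\<lambda>x. ?s (\<gamma>' (?s x))) = links V \<gamma>"
    unfolding links_def by (rule image_cong) (simp_all add: conj)
  finally have mp: "map_prod ?s ?s ` ?E = links V (\<lambda>x. ?s (partner (?s x))) \<union> links V \<gamma>" .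
  have "inj_on ?s V" by (rule inj_on_inverseI[of _ ?s]) (rule reflect_reflect)
  from potential_image[OF this E, of 0]
  \<comment> \<open>The reflection fixes 0, so the base vertex of the potential is
    unchanged.\<close>
  have "potential ?E V 0 = potential (links V (\<lambda>x. ?s (partner (?s x))) \<union> links V \<gamma>) V 0"
    unfolding mp im by (simp add: V_def reflect_def)
  moreover have "potential (links V partner \<union> links V \<gamma>) V 0 \<le>
      potential (links V (\<lambda>x. ?s (partner (?s x))) \<union> links V \<gamma>) V 0 + 1"
  proof (rule potential_two_break[OF _ fp fg(1), of 0 "2 * j"])
    \<comment> \<open>For \<open>1 \<le> i < j\<close> the reflection maps the black edge at
      \<open>2i\<close>, \<open>2i + 1\<close> to the one at \<open>2(j - i)\<close>,
      \<open>2(j - i) + 1\<close>. Conjugation thus only alters the two black edges that cross the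
      borders of the block.\<close>
    show "?s (partner (?s x)) = partner x"
      if "x \<in> V - {0, partner 0, 2 * j, partner (2 * j)}" for x
      using that by (auto simp: reflect_def partner_def)
  qed (use j in \<open>auto simp: V_def reflect_def partner_def\<close>)
  ultimately show ?thesis
    unfolding bg_potential_def Let_def \<pi>'_def[symmetric] len V_def[symmetric]
      \<gamma>_def[symmetric] \<gamma>'_def[symmetric] by simp
qed

section \<open>Potential of the identity\<close>

lemma bg_labels_identity: "bg_labels [1..int n] = map int [0..<2 * n + 2]"
proof -
  have "concat (map label_pair [1..int n]) = map int [1..<2 * n + 1]"
  proof (induction n)
    case (Suc n)
    have "[1..int (Suc n)] = [1..int n] @ [int (Suc n)]"
      using upto_rec2[of 1 "int (Suc n)"] by simp
    then show ?case using Suc by (simp add: label_pair_def)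
  qed simp
  moreover have "map int [0..<2 * n + 2] = 0 # map int [1..<2 * n + 1] @ [2 * int n + 1]"
    by (simp add: upt_conv_Cons)
  ultimately show ?thesis by (simp add: bg_labels_alt)
qed

text \<open>Labels equal positions, so grey and black edges coincide. All \<open>n + 1\<close>
  components are 1-cycles of weight -1, and the correction vanishes.\<close>

lemma bg_potential_identity: "bg_potential [1..int n] = - int n - 1"
proof -
  define V where "V = {..<2 * n + 2}"
  let ?\<pi> = "[1..int n]"
  let ?\<gamma> = "grey_partner (bg_labels ?\<pi>)"
  let ?E = "links V partner \<union> links V ?\<gamma>"
  have "signed_permutation n ?\<pi>"
    by (auto simp: signed_permutation_def distinct_map inj_on_def)
  then have L: "labelling (2 * n + 2) (bg_labels ?\<pi>)" by (rule labelling_bg_labels)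
  have \<gamma>: "?\<gamma> p = partner p" if "p \<in> V" for p
    using that partner_less[of "2 * n + 2" p]
    by (intro grey_partner_eqI[OF L]) (auto simp: V_def bg_labels_identity simp del: upt_Suc)
  have fp: "fpf_involution V partner" unfolding V_def by (rule fpf_involution_partner) simp
  have fg: "fpf_involution V ?\<gamma>" unfolding V_def using L by (rule fpf_involution_grey_partner)
  have fin: "finite V" by (simp add: V_def)
  have c2: "card (?E\<^sup>* `` {p}) = 2" if "p \<in> V" for p
    using card_component_eq_2_iff[OF fin fp fg that] \<gamma>[OF that] by blast
  have E: "?E \<subseteq> V \<times> V" "sym ?E"
    using links_subset[OF fp] links_subset[OF fg] sym_links[OF fp] sym_links[OF fg]
    by (auto intro: sym_Un)
  have c2': "card X = 2" if "X \<in> comps ?E V" for X using that c2 by (auto simp: comps_def)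
  have "2 * card (comps ?E V) = card (\<Union>(comps ?E V))"
    using fin c2' comps_disjoint[OF E(2)] Union_comps[OF E(1)]
    by (intro card_partition) (auto simp: comps_def)
  then have "card (comps ?E V) = n + 1" unfolding Union_comps[OF E(1)] by (simp add: V_def)
  moreover have "(\<Sum>X\<in>comps ?E V. if card X = 2 then -1 else 1 :: int) = - int (card (comps ?E V))"
    using c2' by simp
  moreover have "card (?E\<^sup>* `` {0}) = 2" by (rule c2) (simp add: V_def)
  ultimately show ?thesis
    unfolding bg_potential_def Let_def potential_def length_upto
    by (simp add: V_def)
qed

text \<open>Each reversal lowers the potential by at most one, and the sequence ends at the
  identity, whose potential is \<open>- int n - 1\<close>.\<close>

lemma bg_potential_le_length:
  assumes "signed_permutation n \<pi>" "set js \<subseteq> {1..n}" "fold prefix_reversal js \<pi> = [1..int n]"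
  shows "int n + 1 + bg_potential \<pi> \<le> int (length js)"
  using assms
proof (induction js arbitrary: \<pi>)
  case Nil
  then show ?case by (simp add: bg_potential_identity)
next
  case (Cons j js)
  have "int n + 1 + bg_potential (prefix_reversal j \<pi>) \<le> int (length js)"
    using Cons.prems by (intro Cons.IH signed_permutation_prefix_reversal) auto
  moreover have "bg_potential \<pi> \<le> bg_potential (prefix_reversal j \<pi>) + 1"
    using Cons.prems by (intro bg_potential_prefix_reversal) auto
  ultimately show ?case by simp
qed

text \<open>If the first entry is 1, position 1 carries label 1, the component of 0 is a 1-cycle,
  and both corrections vanish. Otherwise the left side subtracts 2, the largest value the correction
  can take.\<close>

lemma cycle_bound_le_bg_potential:
  assumes \<pi>: "signed_permutation n \<pi>"
  shows "int (num_cycles (breakpoint_graph \<pi>)) - 2 * int (num_1_cycles (breakpoint_graph \<pi>))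
      - (if \<pi> \<noteq> [] \<and> hd \<pi> = 1 then 0 else 2) \<le> bg_potential \<pi>"
proof -
  define V where "V = {..<2 * n + 2}"
  define \<gamma> where "\<gamma> = grey_partner (bg_labels \<pi>)"
  let ?E = "links V partner \<union> links V \<gamma>"
  note L = labelling_bg_labels[OF \<pi>]
  have len: "length \<pi> = n" using \<pi> by (simp add: signed_permutation_def)
  have fin: "finite V" by (simp add: V_def)
  have fp: "fpf_involution V partner" unfolding V_def by (rule fpf_involution_partner) simp
  have fg: "fpf_involution V \<gamma>" unfolding V_def \<gamma>_def using L by (rule fpf_involution_grey_partner)
  have "card (?E\<^sup>* `` {0}) = 2" if hd: "\<pi> \<noteq> [] \<and> hd \<pi> = 1"
  proof -
    obtain xs where "\<pi> = 1 # xs" using hd by (cases \<pi>) auto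
    then have "\<gamma> 0 = 1" unfolding \<gamma>_def using len
      by (intro grey_partner_eqI[OF L]) (auto simp: bg_labels_alt label_pair_def partner_def)
    then show ?thesis using card_component_eq_2_iff[OF fin fp fg, of 0]
      by (simp add: V_def partner_def)
  qed
  then show ?thesis
    using num_cycles_matching_edges[OF fin fp fg] breakpoint_graph_eq_matching_edges[OF \<pi>]
    by (simp add: bg_potential_def potential_def Let_def len V_def \<gamma>_def)
qed

theorem theorem2:
  fixes n :: nat and \<pi> :: "int list"
  assumes "signed_permutation n \<pi>"
  shows "int (psrd \<pi>) \<ge>
    int n + 1 + int (num_cycles (breakpoint_graph \<pi>)) - 2 * int (num_1_cycles (breakpoint_graph \<pi>))
      - (if \<pi> \<noteq> [] \<and> hd \<pi> = 1 then 0 else 2)"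
proof -
  have len: "length \<pi> = n" using assms by (simp add: signed_permutation_def)
  \<comment> \<open>Sortability makes the set under \<open>LEAST\<close> nonempty, so a sequence of
    length \<open>psrd \<pi>\<close> really exists.\<close>
  have "\<exists>k js. length js = k \<and> set js \<subseteq> {1..length \<pi>} \<and>
      fold prefix_reversal js \<pi> = [1..int (length \<pi>)]"
    using signed_permutation_sortable[OF assms] by blast
  then have "\<exists>js. length js = psrd \<pi> \<and> set js \<subseteq> {1..length \<pi>} \<and>
      fold prefix_reversal js \<pi> = [1..int (length \<pi>)]"
    unfolding psrd_def by (rule LeastI_ex)
  then obtain js where js: "length js = psrd \<pi>" "set js \<subseteq> {1..n}"
    "fold prefix_reversal js \<pi> = [1..int n]"
    unfolding len by blast
  show ?thesis
    using bg_potential_le_length[OF assms js(2,3)] cycle_bound_le_bg_potential[OF assms] js(1)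
    by linarith
qed

end
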